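(* Let $n\ge 1$ and $k\ge 1$. Every $k$-dimensional central extension of the $n$-dimensional complex null-filiform Leibniz algebra $NF_n$ is isomorphic (as an algebra) to one of the following non-isomorphic algebras: $$NF_n\oplus\mathbb{C}^k,\qquad NF_{n+1}\oplus\mathbb{C}^{k-1}.$$
   Context: All vector spaces and algebras are finite-dimensional over $\mathbb{C}$. A Leibniz algebra is an algebra $L$ with bilinear product $[-,-]$ satisfying $[x,[y,z]]=[[x,y],z]-[[x,z],y]$ for all $x,y,z\in L$. $NF_m$ denotes the $m$-dimensional (null-filiform) Leibniz algebra with basis $\{e_1,\dots,e_m\}$ and $[e_i,e_1]=e_{i+1}$ for $1\le i\le m-1$, all other products of basis elements being zero. $\mathbb{C}^r$ denotes the $r$-dimensional abelian algebra (zero product), and $\oplus$ denotes direct sum of algebras. A $k$-dimensional central extension of a Leibniz algebra $L$ is a Leibniz algebra $\widehat L$ fitting into a short exact sequence of Leibniz algebras $0\to V\to\widehat L\to L\to 0$ with $\dim V=k$ and the image of $V$ contained in the center of $\widehat L$ (elements $z$ with $[z,\widehat L]=[\widehat L,z]=0$). Equivalently, $\widehat L\cong L_\theta=L\oplus V$ (as a vector space) with product $[x+u,y+v]=[x,y]_L+\theta(x,y)$ for $x,y\in L$, $u,v\in V$, where $\theta:L\times L\to V$ is a bilinear map satisfying $\theta(x,[y,z])=\theta([x,y],z)-\theta([x,z],y)$ for all $x,y,z\in L$. *)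

theory Defs
  imports Complex_Main "HOL-Library.Function_Algebras" "HOL-Library.Product_Plus"
begin

text \<open>
  The underlying vector space of an algebra is a linear subspace \<open>carr A\<close> of an ambient
  complex vector space, namely the type \<open>'a\<close> with its own addition and the scalar
  multiplication \<open>scal A\<close>. This allows families of algebras of varying dimension to live
  on one type. Nothing is required of \<open>brack A\<close> outside \<open>carr A\<close>.
\<close>

record 'a calgebra =
  carr :: "'a set"
  scal :: "complex \<Rightarrow> 'a \<Rightarrow> 'a"
  brack :: "'a \<Rightarrow> 'a \<Rightarrow> 'a"

definition bilinear_bracket :: "'a::ab_group_add calgebra \<Rightarrow> bool" where
  "bilinear_bracket A \<longleftrightarrow>
     (\<forall>x\<in>carr A. \<forall>y\<in>carr A. brack A x y \<in> carr A) \<and>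
     (\<forall>x\<in>carr A. \<forall>y\<in>carr A. \<forall>z\<in>carr A.
        brack A (x + y) z = brack A x z + brack A y z \<and>
        brack A x (y + z) = brack A x y + brack A x z) \<and>
     (\<forall>c. \<forall>x\<in>carr A. \<forall>y\<in>carr A.
        brack A (scal A c x) y = scal A c (brack A x y) \<and>
        brack A x (scal A c y) = scal A c (brack A x y))"

definition fd_algebra :: "'a::ab_group_add calgebra \<Rightarrow> bool" where
  "fd_algebra A \<longleftrightarrow>
     vector_space (scal A) \<and>
     module.subspace (scal A) (carr A) \<and>
     (\<exists>B. finite B \<and> module.span (scal A) B = carr A) \<and>
     bilinear_bracket A"

definition alg_dim :: "'a::ab_group_add calgebra \<Rightarrow> nat" where
  "alg_dim A = vector_space.dim (scal A) (carr A)"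

definition leibniz_algebra :: "'a::ab_group_add calgebra \<Rightarrow> bool" where
  "leibniz_algebra A \<longleftrightarrow> fd_algebra A \<and>
     (\<forall>x\<in>carr A. \<forall>y\<in>carr A. \<forall>z\<in>carr A.
        brack A x (brack A y z) = brack A (brack A x y) z - brack A (brack A x z) y)"

definition alg_hom ::
    "'a::ab_group_add calgebra \<Rightarrow> 'b::ab_group_add calgebra \<Rightarrow> ('a \<Rightarrow> 'b) \<Rightarrow> bool" where
  "alg_hom A B f \<longleftrightarrow>
     (\<forall>x\<in>carr A. f x \<in> carr B) \<and>
     (\<forall>x\<in>carr A. \<forall>y\<in>carr A. f (x + y) = f x + f y) \<and>
     (\<forall>c. \<forall>x\<in>carr A. f (scal A c x) = scal B c (f x)) \<and>
     (\<forall>x\<in>carr A. \<forall>y\<in>carr A. f (brack A x y) = brack B (f x) (f y))"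

definition alg_iso :: "'a::ab_group_add calgebra \<Rightarrow> 'b::ab_group_add calgebra \<Rightarrow> bool"
    (infix "\<cong>\<^sub>A" 50) where
  "A \<cong>\<^sub>A B \<longleftrightarrow> (\<exists>f. alg_hom A B f \<and> bij_betw f (carr A) (carr B))"

definition alg_center :: "'a::ab_group_add calgebra \<Rightarrow> 'a set" where
  "alg_center A = {z \<in> carr A. \<forall>x\<in>carr A. brack A z x = 0 \<and> brack A x z = 0}"

text \<open>Exactness of \<open>0 \<rightarrow> V \<rightarrow> E \<rightarrow> L \<rightarrow> 0\<close>, with maps \<open>i\<close> and \<open>p\<close>.\<close>

definition short_exact ::
    "'v::ab_group_add calgebra \<Rightarrow> ('v \<Rightarrow> 'e) \<Rightarrow> 'e::ab_group_add calgebra \<Rightarrow>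
     ('e \<Rightarrow> 'l) \<Rightarrow> 'l::ab_group_add calgebra \<Rightarrow> bool" where
  "short_exact V i E p L \<longleftrightarrow>
     alg_hom V E i \<and> alg_hom E L p \<and>
     inj_on i (carr V) \<and>
     i ` carr V = {x \<in> carr E. p x = 0} \<and>
     p ` carr E = carr L"

definition central_extension ::
    "nat \<Rightarrow> 'v::ab_group_add calgebra \<Rightarrow> ('v \<Rightarrow> 'e) \<Rightarrow> 'e::ab_group_add calgebra \<Rightarrow>
     ('e \<Rightarrow> 'l) \<Rightarrow> 'l::ab_group_add calgebra \<Rightarrow> bool" where
  "central_extension k V i E p L \<longleftrightarrow>
     leibniz_algebra V \<and> leibniz_algebra E \<and> leibniz_algebra L \<and>
     short_exact V i E p L \<and>
     alg_dim V = k \<and>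
     i ` carr V \<subseteq> alg_center E"

text \<open>\<open>\<complex>\<^sup>m\<close> is realised as the functions \<open>nat \<Rightarrow> complex\<close> supported in \<open>{1..m}\<close>.\<close>

definition coord_space :: "nat \<Rightarrow> (nat \<Rightarrow> complex) set" where
  "coord_space m = {x. \<forall>i. i \<notin> {1..m} \<longrightarrow> x i = 0}"

definition coord_scal :: "complex \<Rightarrow> (nat \<Rightarrow> complex) \<Rightarrow> (nat \<Rightarrow> complex)" where
  "coord_scal c x = (\<lambda>i. c * x i)"

definition basis_vec :: "nat \<Rightarrow> (nat \<Rightarrow> complex)" where
  "basis_vec i = (\<lambda>j. if j = i then 1 else 0)"

definition NF_table :: "nat \<Rightarrow> nat \<Rightarrow> nat \<Rightarrow> (nat \<Rightarrow> complex)" where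
  "NF_table m i j = (if 1 \<le> i \<and> i \<le> m - 1 \<and> j = 1 then basis_vec (i + 1) else 0)"

text \<open>The bracket of \<open>NF m\<close> is the bilinear extension of the multiplication table; see
  \<open>NF_brack_basis\<close> and \<open>leibniz_algebra_NF\<close> below.\<close>

definition NF :: "nat \<Rightarrow> (nat \<Rightarrow> complex) calgebra" where
  "NF m = \<lparr> carr = coord_space m,
            scal = coord_scal,
            brack = (\<lambda>x y. \<Sum>i=1..m. \<Sum>j=1..m. coord_scal (x i * y j) (NF_table m i j)) \<rparr>"

definition abelian_alg :: "nat \<Rightarrow> (nat \<Rightarrow> complex) calgebra" where
  "abelian_alg r = \<lparr> carr = coord_space r, scal = coord_scal, brack = (\<lambda>x y. 0) \<rparr>"

definition direct_sum :: "'a calgebra \<Rightarrow> 'b calgebra \<Rightarrow> ('a \<times> 'b) calgebra"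
    (infixr "\<oplus>\<^sub>A" 65) where
  "A \<oplus>\<^sub>A B =
     \<lparr> carr = carr A \<times> carr B,
       scal = (\<lambda>c (a, b). (scal A c a, scal B c b)),
       brack = (\<lambda>(a, b) (a', b'). (brack A a a', brack B b b')) \<rparr>"

lemma sum_fun_apply: "(\<Sum>i\<in>I. f i) j = (\<Sum>i\<in>I. f i j)"
  for f :: "'i \<Rightarrow> 'j \<Rightarrow> complex"
  by (induction I rule: infinite_finite_induct) auto

lemma NF_brack_apply:
  "brack (NF m) x y j = (if 2 \<le> j \<and> j \<le> m then x (j - 1) * y 1 else 0)"
proof -
  have inner: "(\<Sum>j'=1..m. coord_scal (x i * y j') (NF_table m i j') j)
      = (if i = j - 1 \<and> 2 \<le> j \<and> j \<le> m then x i * y 1 else 0)" if "i \<in> {1..m}" for i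
  proof -
    have "(\<Sum>j'=1..m. coord_scal (x i * y j') (NF_table m i j') j)
      = (\<Sum>j'=1..m. if j' = 1 then coord_scal (x i * y 1) (NF_table m i 1) j else 0)"
      by (rule sum.cong) (auto simp: coord_scal_def NF_table_def)
    also have "\<dots> = coord_scal (x i * y 1) (NF_table m i 1) j"
      using that by (simp add: sum.delta)
    also have "\<dots> = (if i = j - 1 \<and> 2 \<le> j \<and> j \<le> m then x i * y 1 else 0)"
      using that by (auto simp: coord_scal_def NF_table_def basis_vec_def)
    finally show ?thesis .
  qed
  have "brack (NF m) x y j = (\<Sum>i=1..m. if i = j - 1 \<and> 2 \<le> j \<and> j \<le> m then x i * y 1 else 0)"
    unfolding NF_def using inner by (simp only: calgebra.simps sum_fun_apply cong: sum.cong)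
  also have "\<dots> = (\<Sum>i=1..m. if i = j - 1 then (if 2 \<le> j \<and> j \<le> m then x i * y 1 else 0) else 0)"
    by (rule sum.cong) auto
  also have "\<dots> = (if 2 \<le> j \<and> j \<le> m then x (j - 1) * y 1 else 0)"
    by (subst sum.delta) auto
  finally show ?thesis .
qed

lemma NF_brack_basis:
  assumes "i \<in> {1..m}" "j \<in> {1..m}"
  shows "brack (NF m) (basis_vec i) (basis_vec j)
       = (if j = 1 \<and> i \<le> m - 1 then basis_vec (i + 1) else 0)"
  using assms by (intro ext) (auto simp: NF_brack_apply basis_vec_def)

lemma vector_space_coord_scal: "vector_space coord_scal"
  by standard (auto simp: coord_scal_def algebra_simps)

lemma subspace_coord_space: "module.subspace coord_scal (coord_space m)"
proof -
  interpret vector_space coord_scal by (rule vector_space_coord_scal)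
  show ?thesis by (auto simp: subspace_def coord_space_def coord_scal_def)
qed

lemma span_basis_vec: "module.span coord_scal (basis_vec ` {1..m}) = coord_space m"
proof -
  interpret vector_space coord_scal by (rule vector_space_coord_scal)
  show ?thesis
  proof
    show "span (basis_vec ` {1..m}) \<subseteq> coord_space m"
      by (rule span_minimal[OF _ subspace_coord_space])
         (auto simp: coord_space_def basis_vec_def)
    show "coord_space m \<subseteq> span (basis_vec ` {1..m})"
    proof
      fix x assume x: "x \<in> coord_space m"
      have "x j = (\<Sum>i=1..m. coord_scal (x i) (basis_vec i)) j" for j
      proof -
        have "(\<Sum>i=1..m. coord_scal (x i) (basis_vec i)) j
            = (\<Sum>i=1..m. if j = i then x i else 0)"
          unfolding sum_fun_apply by (rule sum.cong) (auto simp: coord_scal_def basis_vec_def)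
        also have "\<dots> = x j"
          using x by (auto simp: coord_space_def)
        finally show ?thesis by simp
      qed
      then have "x = (\<Sum>i=1..m. coord_scal (x i) (basis_vec i))" by (rule ext)
      also have "\<dots> \<in> span (basis_vec ` {1..m})"
        by (intro span_sum span_scale span_base imageI)
      finally show "x \<in> span (basis_vec ` {1..m})" .
    qed
  qed
qed

lemma leibniz_algebra_NF: "leibniz_algebra (NF m)"
proof -
  have br: "brack (NF m) = (\<lambda>x y j. if 2 \<le> j \<and> j \<le> m then x (j - 1) * y 1 else 0)"
    by (intro ext) (rule NF_brack_apply)
  have carr: "carr (NF m) = coord_space m" and scal: "scal (NF m) = coord_scal"
    by (simp_all add: NF_def)
  have "bilinear_bracket (NF m)"
    unfolding bilinear_bracket_def br carr scal
    by (auto simp: coord_space_def coord_scal_def fun_eq_iff distrib_left distrib_right)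
  moreover have "\<exists>B. finite B \<and> module.span coord_scal B = coord_space m"
    using span_basis_vec by blast
  moreover have "brack (NF m) x (brack (NF m) y z)
      = brack (NF m) (brack (NF m) x y) z - brack (NF m) (brack (NF m) x z) y" for x y z
    unfolding br by (rule ext) simp
  ultimately show ?thesis
    by (simp add: leibniz_algebra_def fd_algebra_def carr scal
        vector_space_coord_scal subspace_coord_space)
qed

end

theory Submission
  imports Defs
begin

text \<open>
  Let \<open>E\<close> be a central extension of \<open>NF n\<close> with kernel \<open>Z\<close> of dimension \<open>k\<close>. Since \<open>NF n\<close> is
  generated by \<open>e\<^sub>1\<close>, everything is governed by one lift \<open>x\<close> of \<open>e\<^sub>1\<close> and its left-normed powers
  \<open>x\<^sup>j = [\<dots>[[x, x], x], \<dots>, x]\<close>. For \<open>j \<le> n\<close> the power \<open>x\<^sup>j\<close> lifts \<open>e\<^sub>j\<close>, so \<open>E\<close> is the direct sum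
  of the span of \<open>x, \<dots>, x\<^sup>n\<close> and \<open>Z\<close>. In every Leibniz algebra \<open>[y, x\<^sup>j] = 0\<close> for \<open>j \<ge> 2\<close>
  (\<open>brack_left_power_right\<close>), hence the bracket of \<open>E\<close> is completely determined by right
  multiplication with \<open>x\<close>, which maps \<open>x\<^sup>j\<close> to the next power and kills \<open>Z\<close>. The only freedom left
  is the value \<open>t\<close> of the \<open>(n+1)\<close>-st power of \<open>x\<close>. It maps to \<open>0\<close> in \<open>NF n\<close>, so it lies in \<open>Z\<close> and
  the following power is \<open>0\<close>.

  If \<open>t = 0\<close>, then \<open>x, \<dots>, x\<^sup>n\<close> together with a basis of \<open>Z\<close> has the multiplication table of
  \<open>NF n \<oplus> \<complex>\<^sup>k\<close>. If \<open>t \<noteq> 0\<close>, extend \<open>t\<close> to a basis of \<open>Z\<close>: now \<open>x, \<dots>, x\<^sup>n, t\<close> and the remaining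
  \<open>k - 1\<close> basis vectors have the table of \<open>NF (n+1) \<oplus> \<complex>\<^bsup>k-1\<^esup>\<close>. Both cases use the recognition
  criterion \<open>iso_NF_plus_abelian\<close>.

  The two models are not isomorphic: left-normed powers with \<open>n + 1\<close> factors all vanish in the
  first, whereas in the second such a power of \<open>e\<^sub>1\<close> is \<open>e\<^bsub>n+1\<^esub>\<close> (\<open>NF_plus_abelian_not_iso\<close>).
\<close>

section \<open>Finite-dimensional algebras\<close>

locale fd_alg =
  fixes A :: "'a::ab_group_add calgebra"
  assumes fd: "fd_algebra A"
begin

sublocale vector_space "scal A"
  using fd by (simp add: fd_algebra_def)

lemma subspace_carr: "subspace (carr A)"
  using fd by (simp add: fd_algebra_def)

lemma carr_zero: "0 \<in> carr A"
  and carr_add: "x \<in> carr A \<Longrightarrow> y \<in> carr A \<Longrightarrow> x + y \<in> carr A"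
  and carr_diff: "x \<in> carr A \<Longrightarrow> y \<in> carr A \<Longrightarrow> x - y \<in> carr A"
  and carr_scal: "x \<in> carr A \<Longrightarrow> scal A c x \<in> carr A"
  and carr_sum: "(\<And>i. i \<in> I \<Longrightarrow> f i \<in> carr A) \<Longrightarrow> sum f I \<in> carr A"
  using subspace_carr
  by (auto intro: subspace_0 subspace_add subspace_diff subspace_scale subspace_sum)

lemma carr_brack: "x \<in> carr A \<Longrightarrow> y \<in> carr A \<Longrightarrow> brack A x y \<in> carr A"
  using fd by (simp add: fd_algebra_def bilinear_bracket_def)

lemma brack_add_left:
    "x \<in> carr A \<Longrightarrow> y \<in> carr A \<Longrightarrow> z \<in> carr A \<Longrightarrow> brack A (x + y) z = brack A x z + brack A y z"
  and brack_add_right: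
    "x \<in> carr A \<Longrightarrow> y \<in> carr A \<Longrightarrow> z \<in> carr A \<Longrightarrow> brack A x (y + z) = brack A x y + brack A x z"
  and brack_scal_left:
    "x \<in> carr A \<Longrightarrow> y \<in> carr A \<Longrightarrow> brack A (scal A c x) y = scal A c (brack A x y)"
  and brack_scal_right:
    "x \<in> carr A \<Longrightarrow> y \<in> carr A \<Longrightarrow> brack A x (scal A c y) = scal A c (brack A x y)"
  using fd by (simp_all add: fd_algebra_def bilinear_bracket_def)

lemma brack_zero_left: "y \<in> carr A \<Longrightarrow> brack A 0 y = 0"
  using brack_scal_left[of 0 y 0] carr_zero by simp

lemma brack_zero_right: "x \<in> carr A \<Longrightarrow> brack A x 0 = 0"
  using brack_scal_right[of x 0 0] carr_zero by simp

lemma brack_lincomb_left: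
  assumes "y \<in> carr A" "\<And>i. i \<in> I \<Longrightarrow> x i \<in> carr A"
  shows "brack A (\<Sum>i\<in>I. scal A (c i) (x i)) y = (\<Sum>i\<in>I. scal A (c i) (brack A (x i) y))"
  using assms(2)
  by (induction I rule: infinite_finite_induct)
     (simp_all add: assms(1) brack_zero_left brack_add_left brack_scal_left carr_sum carr_scal)

lemma brack_lincomb_right:
  assumes "y \<in> carr A" "\<And>i. i \<in> I \<Longrightarrow> x i \<in> carr A"
  shows "brack A y (\<Sum>i\<in>I. scal A (c i) (x i)) = (\<Sum>i\<in>I. scal A (c i) (brack A y (x i)))"
  using assms(2)
  by (induction I rule: infinite_finite_induct)
     (simp_all add: assms(1) brack_zero_right brack_add_right brack_scal_right carr_sum carr_scal)

lemma hom_zero: "alg_hom A B f \<Longrightarrow> f 0 = 0" for B :: "'b::ab_group_add calgebra"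
  using carr_zero by (metis add_cancel_right_right add.right_neutral alg_hom_def)

lemma hom_lincomb:
  fixes B :: "'b::ab_group_add calgebra"
  assumes "alg_hom A B f" "\<And>i. i \<in> I \<Longrightarrow> x i \<in> carr A"
  shows "f (\<Sum>i\<in>I. scal A (c i) (x i)) = (\<Sum>i\<in>I. scal B (c i) (f (x i)))"
  using assms(2)
proof (induction I rule: infinite_finite_induct)
  case (insert i I)
  then have "scal A (c i) (x i) \<in> carr A" "(\<Sum>i\<in>I. scal A (c i) (x i)) \<in> carr A"
    by (auto intro: carr_sum carr_scal)
  then show ?case
    using insert assms(1) by (simp add: alg_hom_def)
qed (simp_all add: hom_zero[OF assms(1)])

lemma hom_diff:
  fixes B :: "'b::ab_group_add calgebra"
  assumes "alg_hom A B f" "x \<in> carr A" "y \<in> carr A"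
  shows "f (x - y) = f x - f y"
proof -
  have "f (x - y + y) = f (x - y) + f y"
    using assms carr_diff unfolding alg_hom_def by blast
  then show ?thesis by (simp add: algebra_simps)
qed

lemma iso_sym:
  fixes B :: "'b::ab_group_add calgebra"
  assumes "A \<cong>\<^sub>A B"
  shows "B \<cong>\<^sub>A A"
proof -
  obtain f where f: "alg_hom A B f" "bij_betw f (carr A) (carr B)"
    using assms by (auto simp: alg_iso_def)
  define g where "g = the_inv_into (carr A) f"
  have gf: "g (f x) = x" if "x \<in> carr A" for x
    using that f(2) by (simp add: g_def the_inv_into_f_f bij_betw_def)
  have B: "carr B = f ` carr A"
    using f(2) by (simp add: bij_betw_def)
  have "g (f x + f y) = x + y" "g (scal B c (f x)) = scal A c x"
    "g (brack B (f x) (f y)) = brack A x y" if "x \<in> carr A" "y \<in> carr A" for x y c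
    using f(1) that gf[OF carr_add[OF that]] gf[OF carr_scal[of x c]] gf[OF carr_brack[OF that]]
    by (simp_all add: alg_hom_def)
  then have "alg_hom B A g"
    unfolding alg_hom_def B by (auto simp: gf)
  moreover have "bij_betw g (carr B) (carr A)"
    unfolding g_def by (rule bij_betw_the_inv_into[OF f(2)])
  ultimately show ?thesis by (auto simp: alg_iso_def)
qed

text \<open>
  Vectors of the model algebras are functions of an index, so a basis must be listed as a
  family before its coordinates can be compared with theirs.
\<close>

lemma lincomb_enumerated_basis:
  assumes z: "bij_betw z I B" and B: "finite B" "independent B"
  shows "v \<in> span B \<Longrightarrow> \<exists>c. v = (\<Sum>i\<in>I. scal A (c i) (z i))"
    and "(\<Sum>i\<in>I. scal A (c i) (z i)) = 0 \<Longrightarrow> i \<in> I \<Longrightarrow> c i = 0"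
proof -
  have reindex: "(\<Sum>b\<in>B. scal A (u b) b) = (\<Sum>i\<in>I. scal A (u (z i)) (z i))" for u
    using sum.reindex_bij_betw[OF z, of "\<lambda>b. scal A (u b) b"] by simp
  show "\<exists>c. v = (\<Sum>i\<in>I. scal A (c i) (z i))" if v: "v \<in> span B"
  proof -
    obtain u where "v = (\<Sum>b\<in>B. scal A (u b) b)"
      using v unfolding span_finite[OF B(1)] by (rule rangeE)
    then show ?thesis
      unfolding reindex by (rule exI[where x = "\<lambda>i. u (z i)"])
  qed
  show "c i = 0" if "(\<Sum>i\<in>I. scal A (c i) (z i)) = 0" "i \<in> I"
  proof -
    let ?u = "\<lambda>b. c (the_inv_into I z b)"
    have inv: "the_inv_into I z (z j) = j" if "j \<in> I" for j
      using z that by (simp add: the_inv_into_f_f bij_betw_def)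
    have "(\<Sum>b\<in>B. scal A (?u b) b) = 0"
      unfolding reindex that(1)[symmetric] by (intro sum.cong) (simp_all add: inv)
    moreover have "z i \<in> B"
      using z that(2) by (auto simp: bij_betw_def)
    ultimately have "?u (z i) = 0"
      using independentD[OF B(2,1) subset_refl, of ?u "z i"] by simp
    then show ?thesis using inv that(2) by simp
  qed
qed

end

lemma fd_algebra_abelian: "fd_algebra (abelian_alg r)"
proof -
  interpret vector_space coord_scal by (rule vector_space_coord_scal)
  have "\<exists>B. finite B \<and> span B = coord_space r"
    using span_basis_vec by blast
  moreover have "bilinear_bracket (abelian_alg r)"
    by (auto simp: abelian_alg_def bilinear_bracket_def coord_space_def coord_scal_def)
  ultimately show ?thesis
    by (simp add: fd_algebra_def vector_space_coord_scal subspace_coord_space abelian_alg_def)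
qed

lemma fd_algebra_direct_sum:
  fixes A :: "'a::ab_group_add calgebra" and B :: "'b::ab_group_add calgebra"
  assumes "fd_algebra A" "fd_algebra B"
  shows "fd_algebra (A \<oplus>\<^sub>A B)"
proof -
  interpret A: fd_alg A by standard fact
  interpret B: fd_alg B by standard fact
  let ?s = "scal (A \<oplus>\<^sub>A B)"
  have s: "?s c (a, b) = (scal A c a, scal B c b)" for c a b
    by (simp add: direct_sum_def)
  have carr: "carr (A \<oplus>\<^sub>A B) = carr A \<times> carr B"
    by (simp add: direct_sum_def)
  interpret S: vector_space ?s
    by standard
       (auto simp: s A.scale_right_distrib A.scale_left_distrib B.scale_right_distrib
          B.scale_left_distrib)
  have sub: "S.subspace (carr (A \<oplus>\<^sub>A B))"
    unfolding S.subspace_def carr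
    by (auto simp: s zero_prod_def A.carr_zero B.carr_zero A.carr_add B.carr_add
        A.carr_scal B.carr_scal)
  obtain F where F: "finite F" "A.span F = carr A"
    using assms(1) by (auto simp: fd_algebra_def)
  obtain G where G: "finite G" "B.span G = carr B"
    using assms(2) by (auto simp: fd_algebra_def)
  let ?H = "F \<times> {0} \<union> {0} \<times> G"
  have left: "(a, 0) \<in> S.span ?H" if "a \<in> A.span F" for a
    using that
  proof (induction rule: A.span_induct_alt)
    case base
    show ?case using S.span_zero by (simp add: zero_prod_def)
  next
    case (step c x y)
    then have "?s c (x, 0) + (y, 0) \<in> S.span ?H"
      by (intro S.span_add S.span_scale) (auto intro: S.span_base)
    then show ?case by (simp add: s)
  qed
  have right: "(0, b) \<in> S.span ?H" if "b \<in> B.span G" for b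
    using that
  proof (induction rule: B.span_induct_alt)
    case base
    show ?case using S.span_zero by (simp add: zero_prod_def)
  next
    case (step c x y)
    then have "?s c (0, x) + (0, y) \<in> S.span ?H"
      by (intro S.span_add S.span_scale) (auto intro: S.span_base)
    then show ?case by (simp add: s)
  qed
  have "carr (A \<oplus>\<^sub>A B) \<subseteq> S.span ?H"
  proof
    fix u assume "u \<in> carr (A \<oplus>\<^sub>A B)"
    then have "(fst u, 0) + (0, snd u) \<in> S.span ?H"
      using F(2) G(2) carr by (intro S.span_add left right) auto
    then show "u \<in> S.span ?H" by simp
  qed
  moreover have "S.span ?H \<subseteq> carr (A \<oplus>\<^sub>A B)"
    using F(2) G(2) A.span_superset[of F] B.span_superset[of G] A.carr_zero B.carr_zero
    by (intro S.span_minimal[OF _ sub]) (auto simp: carr)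
  ultimately have "S.span ?H = carr (A \<oplus>\<^sub>A B)" "finite ?H"
    using F(1) G(1) by auto
  moreover have "bilinear_bracket (A \<oplus>\<^sub>A B)"
    by (auto simp: bilinear_bracket_def direct_sum_def A.carr_brack B.carr_brack
        A.brack_add_left A.brack_add_right A.brack_scal_left A.brack_scal_right
        B.brack_add_left B.brack_add_right B.brack_scal_left B.brack_scal_right)
  ultimately show ?thesis
    unfolding fd_algebra_def using S.vector_space_axioms sub by blast
qed

lemma fd_algebra_NF_plus_abelian: "fd_algebra (NF m \<oplus>\<^sub>A abelian_alg r)"
  using leibniz_algebra_NF fd_algebra_abelian
  by (intro fd_algebra_direct_sum) (auto simp: leibniz_algebra_def)

section \<open>Left-normed powers\<close>

text \<open>
  The left-normed power \<open>[[[x, x], x], \<dots>]\<close> with \<open>j\<close> factors, \<open>j \<ge> 1\<close>. Counting factors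
  makes the powers of \<open>e\<^sub>1\<close> in \<open>NF m\<close> exactly the basis vectors \<open>e\<^sub>j\<close>.
\<close>

definition left_power :: "'a::ab_group_add calgebra \<Rightarrow> 'a \<Rightarrow> nat \<Rightarrow> 'a" where
  "left_power A x j = ((\<lambda>y. brack A y x) ^^ (j - 1)) x"

lemma left_power_one: "left_power A x (Suc 0) = x"
  by (simp add: left_power_def)

lemma left_power_Suc: "j \<ge> 1 \<Longrightarrow> left_power A x (Suc j) = brack A (left_power A x j) x"
  by (cases j) (simp_all add: left_power_def)

lemma (in fd_alg) left_power_carr:
  assumes "x \<in> carr A"
  shows "j \<ge> 1 \<Longrightarrow> left_power A x j \<in> carr A"
  by (induction j rule: dec_induct) (simp_all add: left_power_one left_power_Suc carr_brack assms)

lemma (in fd_alg) hom_left_power: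
  fixes B :: "'b::ab_group_add calgebra"
  assumes "alg_hom A B f" "x \<in> carr A"
  shows "j \<ge> 1 \<Longrightarrow> f (left_power A x j) = left_power B (f x) j"
proof (induction j rule: dec_induct)
  case (step j)
  then show ?case
    using assms left_power_carr[OF assms(2), of j] by (simp add: left_power_Suc alg_hom_def)
qed (simp add: left_power_one)

lemma left_power_NF_basis:
  assumes "m \<ge> 1"
  shows "j \<ge> 1 \<Longrightarrow> j \<le> m \<Longrightarrow> left_power (NF m) (basis_vec 1) j = basis_vec j"
proof (induction j rule: dec_induct)
  case (step j)
  then have "j \<le> m - 1" by simp
  then show ?case
    using step assms by (simp add: left_power_Suc NF_brack_basis)
qed (simp add: left_power_one)

text \<open>Right multiplication in \<open>NF m\<close> shifts coordinates up by one, so a left-normed power with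
  more than \<open>m\<close> factors vanishes.\<close>

lemma left_power_NF_low_coord:
  assumes "x \<in> coord_space m"
  shows "j \<ge> 1 \<Longrightarrow> i < j \<Longrightarrow> left_power (NF m) x j i = 0"
proof (induction j arbitrary: i rule: dec_induct)
  case base
  then show ?case using assms by (simp add: left_power_one coord_space_def)
next
  case (step j)
  then show ?case by (simp add: left_power_Suc NF_brack_apply)
qed

lemma left_power_NF_vanishes:
  assumes "x \<in> coord_space m"
  shows "left_power (NF m) x (Suc m) = 0"
proof
  fix i
  interpret NF: fd_alg "NF m"
    using leibniz_algebra_NF[of m] by unfold_locales (simp add: leibniz_algebra_def)
  have "left_power (NF m) x (Suc m) \<in> coord_space m"
    using assms NF.left_power_carr[of x "Suc m"] by (simp add: NF_def)
  then show "left_power (NF m) x (Suc m) i = 0 i"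
    using left_power_NF_low_coord[OF assms, of "Suc m" i]
    by (cases "i < Suc m") (simp_all add: coord_space_def)
qed

lemma left_power_direct_sum:
  fixes A :: "'a::ab_group_add calgebra" and B :: "'b::ab_group_add calgebra"
  shows "j \<ge> 1 \<Longrightarrow> left_power (A \<oplus>\<^sub>A B) (a, b) j = (left_power A a j, left_power B b j)"
  by (induction j rule: dec_induct) (simp_all add: left_power_one left_power_Suc direct_sum_def)

lemma left_power_abelian: "j \<ge> 1 \<Longrightarrow> left_power (abelian_alg r) b (Suc j) = 0"
  by (simp add: left_power_Suc abelian_alg_def)

text \<open>
  An isomorphism preserves the vanishing of all left-normed powers with a given number of
  factors, and this distinguishes the two model algebras.
\<close>

lemma NF_plus_abelian_not_iso:
  assumes "n \<ge> 1" "n < m"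
  shows "\<not> NF n \<oplus>\<^sub>A abelian_alg k \<cong>\<^sub>A NF m \<oplus>\<^sub>A abelian_alg r"
proof
  let ?A = "NF n \<oplus>\<^sub>A abelian_alg k" and ?B = "NF m \<oplus>\<^sub>A abelian_alg r"
  let ?e = "(basis_vec 1, 0) :: (nat \<Rightarrow> complex) \<times> (nat \<Rightarrow> complex)"
  interpret A: fd_alg ?A by standard (rule fd_algebra_NF_plus_abelian)
  assume "?A \<cong>\<^sub>A ?B"
  then obtain f where f: "alg_hom ?A ?B f" "bij_betw f (carr ?A) (carr ?B)"
    by (auto simp: alg_iso_def)
  have "?e \<in> carr ?B"
    using assms by (auto simp: direct_sum_def NF_def abelian_alg_def coord_space_def basis_vec_def)
  then have "?e \<in> f ` carr ?A"
    using f(2) by (simp add: bij_betw_def)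
  then obtain a b where ab: "(a, b) \<in> carr ?A" "f (a, b) = ?e"
    by (metis imageE surj_pair)
  have "a \<in> coord_space n"
    using ab(1) by (simp add: direct_sum_def NF_def)
  then have "left_power ?A (a, b) (Suc n) = 0"
    using assms(1)
    by (simp add: left_power_direct_sum left_power_NF_vanishes left_power_abelian zero_prod_def)
  then have "left_power ?B ?e (Suc n) = 0"
    using A.hom_left_power[OF f(1) ab(1), of "Suc n"] ab(2) A.hom_zero[OF f(1)] by simp
  then have "left_power (NF m) (basis_vec 1) (Suc n) = 0"
    by (simp add: left_power_direct_sum zero_prod_def)
  then have "basis_vec (Suc n) = 0"
    using assms by (simp add: left_power_NF_basis[simplified])
  then have "basis_vec (Suc n) (Suc n) = 0"
    by (simp only: zero_fun_apply)
  then show False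
    by (simp add: basis_vec_def)
qed

section \<open>Recognising a null-filiform algebra with an abelian summand\<close>

locale leibniz_alg = fd_alg A for A :: "'a::ab_group_add calgebra" +
  assumes leibniz: "x \<in> carr A \<Longrightarrow> y \<in> carr A \<Longrightarrow> z \<in> carr A \<Longrightarrow>
    brack A x (brack A y z) = brack A (brack A x y) z - brack A (brack A x z) y"
begin

text \<open>
  With two equal factors on the right the Leibniz identity reads \<open>[y, [x, x]] = 0\<close>; it then
  propagates the vanishing of \<open>[y, x\<^sup>j]\<close> from one \<open>j\<close> to the next.
\<close>

lemma brack_left_power_right:
  assumes x: "x \<in> carr A"
  shows "j \<ge> 2 \<Longrightarrow> y \<in> carr A \<Longrightarrow> brack A y (left_power A x j) = 0"
proof (induction j arbitrary: y rule: dec_induct)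
  case base
  have "brack A y (brack A x x) = 0"
    using leibniz[of y x x] base x by simp
  then show ?case by (simp add: numeral_2_eq_2 left_power_Suc left_power_one)
next
  case (step j)
  let ?p = "left_power A x j"
  have "?p \<in> carr A"
    using step.hyps by (intro left_power_carr x) simp
  then have "brack A y (brack A ?p x) = brack A (brack A y ?p) x - brack A (brack A y x) ?p"
    using step.prems x by (intro leibniz)
  also have "\<dots> = 0"
    using step x by (simp add: carr_brack brack_zero_left)
  finally show ?case using step.hyps by (simp add: left_power_Suc)
qed

text \<open>
  The basis \<open>x, x\<^sup>2, \<dots>, x\<^sup>m, z\<^sub>1, \<dots>, z\<^sub>r\<close> already has the multiplication table of the model:
  only \<open>x\<close> itself acts nontrivially from the right, and it acts by \<open>x\<^sup>i \<mapsto> x\<^bsup>i+1\<^esup>\<close>.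
\<close>

lemma iso_NF_plus_abelian:
  assumes m: "m \<ge> 1" and x: "x \<in> carr A" and nil: "left_power A x (Suc m) = 0"
    and z: "\<And>j. j \<in> {1..r} \<Longrightarrow> z j \<in> alg_center A"
    and spans: "\<And>v. v \<in> carr A \<Longrightarrow>
      \<exists>a b. v = (\<Sum>i=1..m. scal A (a i) (left_power A x i)) + (\<Sum>j=1..r. scal A (b j) (z j))"
    and indep: "\<And>a b. (\<Sum>i=1..m. scal A (a i) (left_power A x i)) +
        (\<Sum>j=1..r. scal A (b j) (z j)) = 0 \<Longrightarrow>
      (\<forall>i\<in>{1..m}. a i = 0) \<and> (\<forall>j\<in>{1..r}. b j = 0)"
  shows "A \<cong>\<^sub>A NF m \<oplus>\<^sub>A abelian_alg r"
proof -
  let ?M = "NF m \<oplus>\<^sub>A abelian_alg r"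
  define P where "P a = (\<Sum>i=1..m. scal A (a i) (left_power A x i))" for a :: "nat \<Rightarrow> complex"
  define Q where "Q b = (\<Sum>j=1..r. scal A (b j) (z j))" for b :: "nat \<Rightarrow> complex"
  define g where "g = (\<lambda>(a, b). P a + Q b)"
  interpret M: fd_alg ?M by standard (rule fd_algebra_NF_plus_abelian)
  have pw: "left_power A x i \<in> carr A" if "i \<in> {1..m}" for i
    using that x by (intro left_power_carr) auto
  have zc: "z j \<in> carr A" if "j \<in> {1..r}" for j
    using z[OF that] by (simp add: alg_center_def)
  have carr: "P a \<in> carr A" "Q b \<in> carr A" for a b
    unfolding P_def Q_def by (auto intro!: carr_sum carr_scal pw zc)
  have add: "P (a + a') = P a + P a'" "Q (b + b') = Q b + Q b'" for a a' b b'
    by (simp_all add: P_def Q_def scale_left_distrib sum.distrib)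
  have scal: "P (coord_scal c a) = scal A c (P a)" "Q (coord_scal c b) = scal A c (Q b)" for a b c
    by (simp_all add: P_def Q_def scale_sum_right coord_scal_def)
  have Q_left: "brack A (Q b) y = 0" if "y \<in> carr A" for b y
    unfolding Q_def using that z zc by (subst brack_lincomb_left) (auto simp: alg_center_def)
  have Q_right: "brack A y (Q b) = 0" if "y \<in> carr A" for b y
    unfolding Q_def using that z zc by (subst brack_lincomb_right) (auto simp: alg_center_def)
  have P_right: "brack A y (P a) = scal A (a 1) (brack A y x)" if y: "y \<in> carr A" for a y
  proof -
    have "brack A y (P a) = (\<Sum>i=1..m. scal A (a i) (brack A y (left_power A x i)))"
      unfolding P_def using y pw by (intro brack_lincomb_right)
    also have "\<dots> = (\<Sum>i\<in>{1..m}. if i = 1 then scal A (a 1) (brack A y x) else 0)"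
      using y x by (intro sum.cong) (auto simp: brack_left_power_right left_power_one)
    also have "\<dots> = scal A (a 1) (brack A y x)"
      using m by simp
    finally show ?thesis .
  qed
  have P_left: "scal A c (brack A (P a) x) = P (\<lambda>j. if 2 \<le> j \<and> j \<le> m then a (j - 1) * c else 0)"
    for a c
  proof -
    have "brack A (P a) x = (\<Sum>i=1..m. scal A (a i) (left_power A x (Suc i)))"
      unfolding P_def using x pw by (subst brack_lincomb_left) (auto simp: left_power_Suc)
    also have "\<dots> = (\<Sum>i=1..<m. scal A (a i) (left_power A x (Suc i)))"
      using m nil by (cases m) (simp_all add: atLeastLessThanSuc_atLeastAtMost)
    also have "\<dots> = (\<Sum>j=2..m. scal A (a (j - 1)) (left_power A x j))"
      using m by (intro sum.reindex_bij_witness[of _ "\<lambda>j. j - 1" Suc]) auto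
    finally have "scal A c (brack A (P a) x) =
        (\<Sum>j=2..m. scal A (a (j - 1) * c) (left_power A x j))"
      by (simp add: scale_sum_right mult.commute)
    also have "\<dots> = P (\<lambda>j. if 2 \<le> j \<and> j \<le> m then a (j - 1) * c else 0)"
      unfolding P_def by (intro sum.mono_neutral_cong_left) auto
    finally show ?thesis .
  qed
  have NF_br: "brack (NF m) a a' = (\<lambda>j. if 2 \<le> j \<and> j \<le> m then a (j - 1) * a' 1 else 0)" for a a'
    by (intro ext) (rule NF_brack_apply)
  have br: "brack A (P a + Q b) (P a' + Q b') = P (brack (NF m) a a')" for a b a' b'
  proof -
    have "brack A (P a + Q b) (P a' + Q b') = brack A (P a) (P a')"
      using carr by (simp add: brack_add_left brack_add_right carr_add Q_left Q_right)
    also have "\<dots> = scal A (a' 1) (brack A (P a) x)"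
      by (intro P_right carr)
    also have "\<dots> = P (brack (NF m) a a')"
      unfolding NF_br by (rule P_left)
    finally show ?thesis .
  qed
  have Q0: "Q 0 = 0" by (simp add: Q_def)
  have hom: "alg_hom ?M A g"
    unfolding alg_hom_def
  proof (intro conjI allI ballI)
    fix u v :: "(nat \<Rightarrow> complex) \<times> (nat \<Rightarrow> complex)" and c
    obtain a b a' b' where uv: "u = (a, b)" "v = (a', b')" by force
    show "g u \<in> carr A"
      by (simp add: uv g_def carr carr_add)
    show "g (u + v) = g u + g v"
      by (simp add: uv g_def add)
    show "g (scal ?M c u) = scal A c (g u)"
      by (simp add: uv g_def direct_sum_def NF_def abelian_alg_def scal scale_right_distrib)
    show "g (brack ?M u v) = brack A (g u) (g v)"
      by (simp add: uv g_def direct_sum_def abelian_alg_def br Q0)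
  qed
  have "u = 0" if "u \<in> carr ?M" "g u = 0" for u
  proof -
    obtain a b where u: "u = (a, b)" by force
    have coord: "a \<in> coord_space m" "b \<in> coord_space r"
      using that(1) by (simp_all add: u direct_sum_def NF_def abelian_alg_def)
    have "P a + Q b = 0"
      using that(2) by (simp add: u g_def)
    then have zero: "\<forall>i\<in>{1..m}. a i = 0" "\<forall>j\<in>{1..r}. b j = 0"
      using indep[of a b] unfolding P_def Q_def by blast+
    have "a i = 0" "b i = 0" for i
      using coord zero unfolding coord_space_def by blast+
    then have "a = 0" "b = 0" by (simp_all add: fun_eq_iff)
    then show ?thesis by (simp add: u zero_prod_def)
  qed
  then have "inj_on g (carr ?M)"
    by (intro inj_onI) (metis M.carr_diff M.hom_diff[OF hom] right_minus_eq)
  moreover have "v \<in> g ` carr ?M" if v: "v \<in> carr A" for v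
  proof -
    obtain a b where ab: "v = P a + Q b"
      using spans[OF v] by (auto simp: P_def Q_def)
    let ?a = "\<lambda>i. if i \<in> {1..m} then a i else 0" and ?b = "\<lambda>j. if j \<in> {1..r} then b j else 0"
    have "P ?a = P a" "Q ?b = Q b"
      unfolding P_def Q_def by (auto intro: sum.cong)
    then have "v = g (?a, ?b)"
      by (simp add: g_def ab)
    moreover have "(?a, ?b) \<in> carr ?M"
      by (auto simp: direct_sum_def NF_def abelian_alg_def coord_space_def)
    ultimately show ?thesis by (rule image_eqI)
  qed
  ultimately have "bij_betw g (carr ?M) (carr A)"
    using hom unfolding bij_betw_def alg_hom_def by blast
  then have "?M \<cong>\<^sub>A A" using hom by (auto simp: alg_iso_def)
  then show ?thesis by (rule M.iso_sym)
qed

end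

section \<open>Central extensions\<close>

lemma leibniz_algI: "leibniz_algebra A \<Longrightarrow> leibniz_alg A"
  by unfold_locales (auto simp: leibniz_algebra_def)

lemma NF_coordinates:
  assumes "a \<in> coord_space n"
  shows "(\<Sum>i=1..n. coord_scal (a i) (basis_vec i)) = a"
proof
  fix j
  have "(\<Sum>i=1..n. coord_scal (a i) (basis_vec i)) j = (\<Sum>i=1..n. if j = i then a i else 0)"
    unfolding sum_fun_apply by (rule sum.cong) (auto simp: coord_scal_def basis_vec_def)
  then show "(\<Sum>i=1..n. coord_scal (a i) (basis_vec i)) j = a j"
    using assms by (auto simp: coord_space_def)
qed

text \<open>
  A homomorphism is linear on its carrier only and may be anything elsewhere, so the basis is
  carried over through explicit linear combinations inside the carrier. For a central extension
  this turns the dimension of \<open>V\<close> into the size of a basis of the kernel inside \<open>E\<close>.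
\<close>

lemma image_basis_of_injective_hom:
  fixes E :: "'e::ab_group_add calgebra" and V :: "'v::ab_group_add calgebra"
  assumes "fd_algebra V" "fd_algebra E" and hom: "alg_hom V E i" and inj: "inj_on i (carr V)"
  shows "\<exists>B. finite B \<and> card B = alg_dim V \<and> \<not> module.dependent (scal E) B \<and>
    module.span (scal E) B = i ` carr V"
proof -
  interpret V: fd_alg V by standard fact
  interpret E: fd_alg E by standard fact
  obtain F where F: "finite F" "V.span F = carr V"
    using assms(1) by (auto simp: fd_algebra_def)
  obtain C where C: "C \<subseteq> carr V" "V.independent C" "carr V \<subseteq> V.span C" "card C = V.dim (carr V)"
    using V.basis_exists by blast
  have fin: "finite C"
    using V.independent_span_bound[OF F(1) C(2)] C(1) F(2) by simp
  have injC: "inj_on i C"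
    using inj C(1) by (rule inj_on_subset)
  have lin: "(\<Sum>b\<in>i ` C. scal E (u b) b) = i (\<Sum>v\<in>C. scal V (u (i v)) v)" for u
    using V.hom_lincomb[OF hom, of C "\<lambda>v. v" "\<lambda>v. u (i v)"] C(1)
    by (simp add: sum.reindex[OF injC] subset_iff)
  have inV: "(\<Sum>v\<in>C. scal V (c v) v) \<in> carr V" for c
    using C(1) by (auto intro!: V.carr_sum V.carr_scal)
  have "E.independent (i ` C)"
  proof (rule E.independent_if_scalars_zero)
    fix u b assume u: "(\<Sum>b\<in>i ` C. scal E (u b) b) = 0" and "b \<in> i ` C"
    then obtain v where v: "v \<in> C" "b = i v" by blast
    have "i (\<Sum>v\<in>C. scal V (u (i v)) v) = i 0"
      using u lin V.hom_zero[OF hom] by simp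
    then have "(\<Sum>v\<in>C. scal V (u (i v)) v) = 0"
      using inj inV V.carr_zero by (auto dest: inj_onD)
    then show "u b = 0"
      using V.independentD[OF C(2) fin subset_refl, of "\<lambda>v. u (i v)" v] v by simp
  qed (use fin in simp)
  moreover have "E.span (i ` C) = i ` carr V"
  proof
    show "E.span (i ` C) \<subseteq> i ` carr V"
      using lin inV by (auto simp: E.span_finite fin)
    show "i ` carr V \<subseteq> E.span (i ` C)"
    proof
      fix y assume "y \<in> i ` carr V"
      then obtain v where v: "v \<in> V.span C" "y = i v" using C(3) by auto
      then obtain c where c: "v = (\<Sum>w\<in>C. scal V (c w) w)"
        by (auto simp: V.span_finite fin)
      have "y = (\<Sum>w\<in>C. scal E (c w) (i w))"
        unfolding v(2) c using C(1) by (intro V.hom_lincomb[OF hom]) auto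
      also have "\<dots> \<in> E.span (i ` C)"
        by (rule E.span_sum) (simp add: E.span_scale E.span_base)
      finally show "y \<in> E.span (i ` C)" .
    qed
  qed
  moreover have "card (i ` C) = alg_dim V"
    using C(4) by (simp add: card_image injC alg_dim_def)
  ultimately show ?thesis using fin by blast
qed

text \<open>
  With respect to the section \<open>e\<^sub>j \<mapsto> x\<^sup>j\<close> the cocycle of the extension vanishes on all pairs of basis
  vectors except \<open>(e\<^sub>n, e\<^sub>1)\<close>, where its value is the \<open>(n+1)\<close>-st power \<open>?t\<close> of \<open>x\<close>. The two cases
  are whether this central vector vanishes.
\<close>

lemma central_extension_NF_cases:
  fixes V :: "'v::ab_group_add calgebra" and E :: "'e::ab_group_add calgebra"
  assumes n: "n \<ge> 1" and k: "k \<ge> 1" and ext: "central_extension k V i E p (NF n)"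
  shows "E \<cong>\<^sub>A NF n \<oplus>\<^sub>A abelian_alg k \<or> E \<cong>\<^sub>A NF (Suc n) \<oplus>\<^sub>A abelian_alg (k - 1)"
proof -
  have V: "fd_algebra V" and E: "leibniz_algebra E" and homi: "alg_hom V E i"
    and homp: "alg_hom E (NF n) p" and inj: "inj_on i (carr V)"
    and exact: "i ` carr V = {x \<in> carr E. p x = 0}" and surj: "p ` carr E = carr (NF n)"
    and dimV: "alg_dim V = k" and central: "i ` carr V \<subseteq> alg_center E"
    using ext by (auto simp: central_extension_def short_exact_def leibniz_algebra_def)
  interpret E: leibniz_alg E using E by (rule leibniz_algI)
  define Z where "Z = i ` carr V"
  have scalNF: "scal (NF n) = coord_scal" and carrNF: "carr (NF n) = coord_space n"
    by (simp_all add: NF_def)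
  have "basis_vec 1 \<in> p ` carr E"
    using n unfolding surj carrNF by (auto simp: coord_space_def basis_vec_def)
  then obtain x where x: "x \<in> carr E" "p x = basis_vec 1" by auto
  let ?w = "\<lambda>j. left_power E x j"
  have w: "?w j \<in> carr E" if "j \<in> {1..n}" for j
    using that x by (intro E.left_power_carr) auto
  have pw: "p (?w j) = basis_vec j" if "j \<in> {1..n}" for j
    using that n E.hom_left_power[OF homp x(1), of j] left_power_NF_basis[OF n, of j] x(2) by simp
  let ?t = "?w (Suc n)"
  have "?t \<in> carr E" using x by (intro E.left_power_carr) auto
  moreover have "p ?t = 0"
    using E.hom_left_power[OF homp x(1), of "Suc n"] x(2) n
    by (simp add: left_power_NF_vanishes coord_space_def basis_vec_def)
  ultimately have t: "?t \<in> Z" by (simp add: Z_def exact)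
  have cent: "v \<in> alg_center E" if "v \<in> Z" for v
    using that central by (auto simp: Z_def)
  have p_coord: "p (\<Sum>i=1..n. scal E (a i) (?w i)) = (\<Sum>i=1..n. coord_scal (a i) (basis_vec i))"
    for a
  proof -
    have "p (\<Sum>i=1..n. scal E (a i) (?w i)) = (\<Sum>i=1..n. coord_scal (a i) (p (?w i)))"
      unfolding scalNF[symmetric] using w by (intro E.hom_lincomb[OF homp])
    also have "\<dots> = (\<Sum>i=1..n. coord_scal (a i) (basis_vec i))"
      by (intro sum.cong) (simp_all add: pw)
    finally show ?thesis .
  qed
  obtain B0 where B0: "finite B0" "card B0 = k" "E.independent B0" "E.span B0 = Z"
    using image_basis_of_injective_hom[OF V E.fd homi inj] dimV by (auto simp: Z_def)
  have subZ: "E.subspace Z" using B0(4) E.subspace_span by metis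
  have split: "\<exists>a. \<exists>y\<in>Z. v = (\<Sum>i=1..n. scal E (a i) (?w i)) + y" if v: "v \<in> carr E" for v
  proof -
    let ?s = "\<Sum>i=1..n. scal E (p v i) (?w i)"
    have s: "?s \<in> carr E" by (auto intro!: E.carr_sum E.carr_scal w)
    have "p v \<in> coord_space n" using v surj carrNF by blast
    then have "p (v - ?s) = 0"
      using E.hom_diff[OF homp v s] p_coord[of "p v"] NF_coordinates by simp
    then have "v - ?s \<in> Z" using E.carr_diff[OF v s] by (simp add: Z_def exact)
    then show ?thesis by (intro exI[of _ "p v"] bexI[of _ "v - ?s"]) auto
  qed
  have zero_coord: "(\<forall>i\<in>{1..n}. a i = 0) \<and> y = 0"
    if eq: "(\<Sum>i=1..n. scal E (a i) (?w i)) + y = 0" and y: "y \<in> Z" for a y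
  proof -
    \<comment> \<open>Only the values of \<open>a\<close> on \<open>{1..n}\<close> matter; cut it off to get a vector of \<open>coord_space n\<close>.\<close>
    let ?s = "\<Sum>i=1..n. scal E (a i) (?w i)" and ?a = "\<lambda>i. if i \<in> {1..n} then a i else 0"
    have "?s = - y" using eq by (simp add: eq_neg_iff_add_eq_0)
    then have "?s \<in> Z" using y subZ E.subspace_neg by simp
    then have "0 = p ?s" by (simp add: Z_def exact)
    also have "\<dots> = (\<Sum>i=1..n. coord_scal (?a i) (basis_vec i))"
      unfolding p_coord by (intro sum.cong) auto
    also have "\<dots> = ?a" by (rule NF_coordinates) (simp add: coord_space_def)
    finally have "?a i = 0" for i by (metis zero_fun_apply)
    then have a0: "\<forall>i\<in>{1..n}. a i = 0" by metis
    then have "?s = 0" by simp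
    then show ?thesis using eq a0 by simp
  qed
  show ?thesis
  proof (cases "?t = 0")
    case True
    obtain z where z: "bij_betw z {1..k} B0"
      using B0(1,2) ex_bij_betw_nat_finite_1 by blast
    have zZ: "z j \<in> Z" if "j \<in> {1..k}" for j
      using z that B0(4) E.span_base by (auto simp: bij_betw_def)
    note basis = E.lincomb_enumerated_basis[OF z B0(1,3)]
    have "E \<cong>\<^sub>A NF n \<oplus>\<^sub>A abelian_alg k"
    proof (rule E.iso_NF_plus_abelian[OF n x(1) True])
      fix j assume "j \<in> {1..k}" then show "z j \<in> alg_center E" by (intro cent zZ)
    next
      fix v assume "v \<in> carr E"
      then show "\<exists>a b. v = (\<Sum>i=1..n. scal E (a i) (?w i)) + (\<Sum>j=1..k. scal E (b j) (z j))"
        using split basis(1) B0(4) by metis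
    next
      fix a b assume eq: "(\<Sum>i=1..n. scal E (a i) (?w i)) + (\<Sum>j=1..k. scal E (b j) (z j)) = 0"
      have "(\<Sum>j=1..k. scal E (b j) (z j)) \<in> Z"
        by (intro E.subspace_sum E.subspace_scale subZ zZ)
      then show "(\<forall>i\<in>{1..n}. a i = 0) \<and> (\<forall>j\<in>{1..k}. b j = 0)"
        using zero_coord[OF eq] basis(2) by blast
    qed
    then show ?thesis ..
  next
    case False
    have "E.independent {?t}" using False by simp
    then obtain B where B: "{?t} \<subseteq> B" "B \<subseteq> Z" "E.independent B" "Z \<subseteq> E.span B"
      using E.maximal_independent_subset_extend[of "{?t}" Z] t by blast
    have spanB: "E.span B = Z"
      using B(2,4) subZ E.span_minimal by blast
    have finB: "finite B"
      using E.independent_span_bound[OF B0(1) B(3)] B(2) B0(4) by simp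
    have "card B = k"
      using E.dim_eq_card[of B Z] E.dim_eq_card[of B0 Z] B(3) B0 spanB subZ
      by (metis E.span_eq_iff)
    then have "card (B - {?t}) = k - 1" using B(1) finB by simp
    then obtain z0 where z0: "bij_betw z0 {1..k - 1} (B - {?t})"
      using finB ex_bij_betw_nat_finite_1 by (metis finite_Diff)
    \<comment> \<open>Placing \<open>?t\<close> last makes the first \<open>k - 1\<close> vectors of \<open>z\<close> the abelian summand, while
      all \<open>k\<close> of them still form a basis of the kernel.\<close>
    define z where "z = z0(k := ?t)"
    have "bij_betw z {1..k - 1} (B - {?t})"
      using z0 by (rule bij_betw_cong[THEN iffD1, rotated]) (use k in \<open>auto simp: z_def\<close>)
    then have "bij_betw z (insert k {1..k - 1}) (insert (z k) (B - {?t}))"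
      using notIn_Un_bij_betw[of k "{1..k - 1}" z "B - {?t}"] k by (simp add: z_def)
    moreover have "insert k {1..k - 1} = {1..k}" "insert (z k) (B - {?t}) = B"
      using k B(1) by (auto simp: z_def)
    ultimately have z: "bij_betw z {1..k} B" by simp
    have zZ: "z j \<in> Z" if "j \<in> {1..k}" for j
      using z that B(2) by (auto simp: bij_betw_def)
    note basis = E.lincomb_enumerated_basis[OF z finB B(3)]
    have k_split: "(\<Sum>j=1..k. scal E (b j) (z j)) =
        scal E (b k) ?t + (\<Sum>j=1..k - 1. scal E (b j) (z j))" for b
      using k by (cases k) (simp_all add: z_def add.commute)
    have n_split: "(\<Sum>i=1..Suc n. scal E (a i) (?w i)) =
        (\<Sum>i=1..n. scal E (a i) (?w i)) + scal E (a (Suc n)) ?t" for a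
      by simp
    have "brack E ?t x = 0" using cent[OF t] x(1) by (simp add: alg_center_def)
    then have nil: "?w (Suc (Suc n)) = 0" by (simp add: left_power_Suc)
    have "E \<cong>\<^sub>A NF (Suc n) \<oplus>\<^sub>A abelian_alg (k - 1)"
    proof (rule E.iso_NF_plus_abelian[where z = z, OF _ x(1) nil])
      fix j assume "j \<in> {1..k - 1}" then show "z j \<in> alg_center E" by (intro cent zZ) auto
    next
      fix v assume "v \<in> carr E"
      then obtain a b where
        v: "v = (\<Sum>i=1..n. scal E (a i) (?w i)) + (\<Sum>j=1..k. scal E (b j) (z j))"
        using split basis(1) spanB by metis
      \<comment> \<open>The coefficient of \<open>?t\<close> moves from the kernel part to the null-filiform part.\<close>
      let ?a = "a(Suc n := b k)"
      have "(\<Sum>i=1..n. scal E (?a i) (?w i)) = (\<Sum>i=1..n. scal E (a i) (?w i))"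
        by (intro sum.cong) auto
      then have "v = (\<Sum>i=1..Suc n. scal E (?a i) (?w i)) + (\<Sum>j=1..k - 1. scal E (b j) (z j))"
        unfolding v n_split k_split by (simp add: add.assoc)
      then show "\<exists>a b. v = (\<Sum>i=1..Suc n. scal E (a i) (?w i)) +
          (\<Sum>j=1..k - 1. scal E (b j) (z j))"
        by blast
    next
      fix a b
      assume eq: "(\<Sum>i=1..Suc n. scal E (a i) (?w i)) + (\<Sum>j=1..k - 1. scal E (b j) (z j)) = 0"
      let ?b = "b(k := a (Suc n))"
      let ?y = "\<Sum>j=1..k. scal E (?b j) (z j)"
      have "(\<Sum>j=1..k - 1. scal E (?b j) (z j)) = (\<Sum>j=1..k - 1. scal E (b j) (z j))"
        using k by (intro sum.cong) auto
      then have "(\<Sum>i=1..n. scal E (a i) (?w i)) + ?y = 0"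
        using eq unfolding n_split k_split by (simp add: add.assoc)
      moreover have "?y \<in> Z"
        by (intro E.subspace_sum E.subspace_scale subZ zZ)
      ultimately have a0: "\<forall>i\<in>{1..n}. a i = 0" and "?y = 0"
        using zero_coord by blast+
      then have b0: "?b j = 0" if "j \<in> {1..k}" for j
        using basis(2) that by blast
      have "a (Suc n) = 0" using b0[of k] k by simp
      moreover have "b j = 0" if "j \<in> {1..k - 1}" for j
      proof -
        have "j \<in> {1..k}" "j \<noteq> k" using that k by auto
        then show ?thesis using b0[of j] by simp
      qed
      ultimately show "(\<forall>i\<in>{1..Suc n}. a i = 0) \<and> (\<forall>j\<in>{1..k - 1}. b j = 0)"
        using a0 by (auto simp: le_Suc_eq)
    qed simp
    then show ?thesis ..
  qed
qed

theorem theorem3p2: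
  fixes n k :: nat
  assumes "n \<ge> 1" and "k \<ge> 1"
  shows "(\<forall>(V :: 'v::ab_group_add calgebra) i (E :: 'e::ab_group_add calgebra) p.
            central_extension k V i E p (NF n) \<longrightarrow>
              E \<cong>\<^sub>A NF n \<oplus>\<^sub>A abelian_alg k \<or>
              E \<cong>\<^sub>A NF (n + 1) \<oplus>\<^sub>A abelian_alg (k - 1))
         \<and> \<not> (NF n \<oplus>\<^sub>A abelian_alg k \<cong>\<^sub>A NF (n + 1) \<oplus>\<^sub>A abelian_alg (k - 1))"
proof (intro conjI allI impI)
  fix V :: "'v calgebra" and i and E :: "'e calgebra" and p
  assume "central_extension k V i E p (NF n)"
  then show "E \<cong>\<^sub>A NF n \<oplus>\<^sub>A abelian_alg k \<or>
      E \<cong>\<^sub>A NF (n + 1) \<oplus>\<^sub>A abelian_alg (k - 1)"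
    using central_extension_NF_cases[OF assms] by simp
next
  show "\<not> (NF n \<oplus>\<^sub>A abelian_alg k \<cong>\<^sub>A NF (n + 1) \<oplus>\<^sub>A abelian_alg (k - 1))"
    using assms by (intro NF_plus_abelian_not_iso) simp_all
qed

end
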